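(* Let $\Lambda$ be an AR language satisfying $(Rabc)$. Let $\lambda_2$ be the stage of the first rule $(c)$, $\mu_a$ the stage of the first rule $(a)$ after $\lambda_2$, $\mu_b$ the stage of the first rule $(b)$ after $\lambda_2$, and let $x$ and $y$ be the elements of $\{a,b\}$ such that $\mu_x<\mu_y$. Let $X,Y$ be the capital letters corresponding to $x,y$ (so $X_p=A_p$ if $x=a$, $X_p=B_p$ if $x=b$, and similarly for $Y_p$). Then, for $p\ge 0$: $Y_p$ clusters if and only if $p\le\mu_x$; $C_p$ clusters if and only if $p\leq\mu_y$; and $X_p$ clusters if and only if $p\le\mu_y$.
   Context: AR (Arnoux-Rauzy) languages. The alphabet is $\{a,b,c\}$. Given an infinite sequence of rules $(x_k)_{k\ge0}$, $x_k\in\{a,b,c\}$, in which each of $a,b,c$ occurs infinitely often, define words by $A_0=a$, $B_0=b$, $C_0=c$ and: by rule $(a)$ at stage $k$ (i.e. $x_k=a$), $A_{k+1}=A_k$, $B_{k+1}=B_kA_k$, $C_{k+1}=C_kA_k$; by rule $(b)$, $A_{k+1}=A_kB_k$, $B_{k+1}=B_k$, $C_{k+1}=C_kB_k$; by rule $(c)$, $A_{k+1}=A_kC_k$, $B_{k+1}=B_kC_k$, $C_{k+1}=C_k$. The AR language $\Lambda$ is the set of all factors of the words $A_k,B_k,C_k$, $k\ge0$. $(Rabc)$: the rule at stage $0$ is $(a)$ and the first rule different from $(a)$ is $(b)$. Clustering. For a total order on the alphabet, written $a_1<\dots<a_r$, the Burrows-Wheeler transform $B(w)$ of a word $w=w_1\cdots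 w_n$ is obtained by listing its $n$ cyclic conjugates $w_i\cdots w_nw_1\cdots w_{i-1}$ (with multiplicity) in nondecreasing lexicographical order and reading the sequence of their last letters. The word $w$ clusters for this order and a permutation $\pi\neq \mathrm{Id}$ of the alphabet if $B(w)=(\pi a_1)^{n_{\pi a_1}}\cdots(\pi a_r)^{n_{\pi a_r}}$, where $n_a\ge0$ is the number of occurrences of $a$ in $w$. "$w$ clusters" (with no order or permutation specified) means that $w$ clusters for some order on $\{a,b,c\}$ and some permutation $\pi\ne\mathrm{Id}$. *)

theory Defs
  imports "HOL-Library.Sublist"
begin

section \<open>Clustering for the Burrows-Wheeler transform\<close>

text \<open>
  An order on the alphabet is passed as a pair \<open>le\<close>, \<open>lt\<close> (non-strict and strict part) that is
  meant to satisfy \<open>class.linorder le lt\<close>.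
\<close>

definition lex_le :: "('a \<Rightarrow> 'a \<Rightarrow> bool) \<Rightarrow> 'a list \<Rightarrow> 'a list \<Rightarrow> bool" where
  "lex_le lt u v \<longleftrightarrow> u = v \<or> (u, v) \<in> lexord {(x, y). lt x y}"

definition conjugates :: "'a list \<Rightarrow> 'a list list" where
  "conjugates w = map (\<lambda>i. rotate i w) [0..<length w]"

definition bwt :: "('a \<Rightarrow> 'a \<Rightarrow> bool) \<Rightarrow> 'a list \<Rightarrow> 'a list" where
  "bwt lt w = map last (linorder.sort_key (lex_le lt) (\<lambda>u. u) (conjugates w))"

definition clusters_for ::
  "('a::finite \<Rightarrow> 'a \<Rightarrow> bool) \<Rightarrow> ('a \<Rightarrow> 'a \<Rightarrow> bool) \<Rightarrow> ('a \<Rightarrow> 'a) \<Rightarrow> 'a list \<Rightarrow> bool" where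
  "clusters_for le lt \<pi> w \<longleftrightarrow>
     bwt lt w =
       concat (map (\<lambda>x. replicate (count_list w (\<pi> x)) (\<pi> x)) (linorder.sorted_list_of_set le UNIV))"

definition clusters :: "'a::finite list \<Rightarrow> bool" where
  "clusters w \<longleftrightarrow>
     (\<exists>le lt \<pi>. class.linorder le lt \<and> bij \<pi> \<and> \<pi> \<noteq> id \<and> clusters_for le lt \<pi> w)"

section \<open>Arnoux-Rauzy languages\<close>

datatype letter = La | Lb | Lc

instance letter :: finite
proof
  have "(UNIV :: letter set) = {La, Lb, Lc}"
    using letter.exhaust by auto
  then show "finite (UNIV :: letter set)"
    by (metis finite.emptyI finite.insertI)
qed

text \<open>
  The words \<open>A\<^sub>k\<close>, \<open>B\<^sub>k\<close>, \<open>C\<^sub>k\<close> are \<open>ar_word x k La\<close>, \<open>ar_word x k Lb\<close>, \<open>ar_word x k Lc\<close>: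
  rule \<open>x k\<close> keeps the word of its own letter and appends that word to the other two.
\<close>

primrec ar_word :: "(nat \<Rightarrow> letter) \<Rightarrow> nat \<Rightarrow> letter \<Rightarrow> letter list" where
  "ar_word x 0 z = [z]"
| "ar_word x (Suc k) z =
     (if z = x k then ar_word x k z else ar_word x k z @ ar_word x k (x k))"

definition ar_language :: "(nat \<Rightarrow> letter) \<Rightarrow> letter list set \<Rightarrow> bool" where
  "ar_language x \<Lambda> \<longleftrightarrow>
     (\<forall>z. infinite {k. x k = z}) \<and> \<Lambda> = {u. \<exists>k z. sublist u (ar_word x k z)}"

definition Rabc :: "(nat \<Rightarrow> letter) \<Rightarrow> bool" where
  "Rabc x \<longleftrightarrow> x 0 = La \<and> x (LEAST k. x k \<noteq> La) = Lb"

definition first_c :: "(nat \<Rightarrow> letter) \<Rightarrow> nat" where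
  "first_c x = (LEAST k. x k = Lc)"

definition first_after_c :: "(nat \<Rightarrow> letter) \<Rightarrow> letter \<Rightarrow> nat" where
  "first_after_c x z = (LEAST k. first_c x < k \<and> x k = z)"

end

theory Submission
  imports Defs "HOL-Library.Multiset"
begin

text \<open>
  A word clusters when the last letters of its sorted conjugates are sorted for a second order, the
  one carried by the permutation. So the whole question is whether one can choose two
  different orders, \<open><\<close> and \<open><'\<close>, such that \<open>u < v\<close> (lexicographically) never holds for conjugates \<open>u\<close>, \<open>v\<close> of the
  word with \<open>last v <' last u\<close> (\<open>clusters_for_iff\<close>).

  This is decided by peeling off the rules one at a time from the outside. Applying rule \<open>l\<close> first
  means that the word is the image of a shorter Arnoux-Rauzy word \<open>u\<close> under the substitution
  \<open>z \<mapsto> z l\<close>, \<open>l \<mapsto> l\<close>. Its conjugates are of two kinds: images of conjugates of \<open>u\<close> under the mirror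
  substitution \<open>z \<mapsto> l z\<close>, \<open>l \<mapsto> l\<close>, which begin with \<open>l\<close>, compare as their preimages do and have the
  same last letters; and words from some \<open>x \<noteq> l\<close> to \<open>l\<close>. Comparing two of the first kind repeats the
  question for \<open>u\<close>; comparing one of each kind looks at first letters only, and says that
  \<open>l < t \<longleftrightarrow> s <' l\<close> for all letters \<open>s\<close>, \<open>t\<close> of \<open>u\<close> other than \<open>l\<close>. In particular \<open>l\<close> lies below or
  above all other letters of \<open>u\<close> (\<open>last_letters_monotone_subst_after\<close>). Hence \<open>ar_word r p z\<close> clusters if
  and only if two different orders meet this condition at every stage \<open>k < p\<close>, on the letters
  \<open>z, r (k+1), \<dots>, r (p-1)\<close> (\<open>clusters_ar_word_iff_compatible\<close>).

  The orders \<open>a < c < b\<close> and \<open>b <' c <' a\<close> meet the conditions of all rules \<open>(a)\<close> and \<open>(b)\<close>, and that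
  of a rule \<open>(c)\<close> unless both \<open>a\<close> and \<open>b\<close> remain among the letters after it. If both remain after
  the first rule \<open>(c)\<close>, at stage \<open>n\<close>, then the conditions at stage \<open>0\<close>, at the first rule \<open>(b)\<close> and at stage \<open>n\<close>
  each involve both other letters, so that each of the three letters would have to be extremal in
  one linear order. So the word
  clusters exactly when \<open>p \<le> n\<close> or one of \<open>a\<close>, \<open>b\<close> is missing from \<open>z, r (n+1), \<dots>, r (p-1)\<close>
  (\<open>clusters_ar_word_iff\<close>). A letter other than \<open>z\<close> enters that list as soon as \<open>p\<close> exceeds its
  first stage after \<open>n\<close>, which yields the three bounds.
\<close>

section \<open>Clustering as monotonicity of last letters\<close>

definition last_letters_monotone :: "('a \<Rightarrow> 'a \<Rightarrow> bool) \<Rightarrow> ('a \<Rightarrow> 'a \<Rightarrow> bool) \<Rightarrow> 'a list \<Rightarrow> bool" where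
  "last_letters_monotone lt lt' w \<longleftrightarrow>
     (\<forall>u \<in> set (conjugates w). \<forall>v \<in> set (conjugates w).
        (u, v) \<in> lexord {(x, y). lt x y} \<longrightarrow> \<not> lt' (last v) (last u))"

text \<open>
  The order \<open>\<pi> a\<^sub>1 < \<pi> a\<^sub>2 < \<dots>\<close> of the blocks of a clustered transform, where \<open>a\<^sub>1 < a\<^sub>2 < \<dots>\<close> is
  the order \<open>lt\<close>.
\<close>

definition pull_order :: "('a \<Rightarrow> 'a) \<Rightarrow> ('a \<Rightarrow> 'a \<Rightarrow> bool) \<Rightarrow> 'a \<Rightarrow> 'a \<Rightarrow> bool" where
  "pull_order \<pi> lt x y \<longleftrightarrow> lt (inv \<pi> x) (inv \<pi> y)"

lemma linorder_pull_order:
  assumes "class.linorder le lt" and "bij \<pi>"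
  shows "class.linorder (pull_order \<pi> le) (pull_order \<pi> lt)"
proof -
  interpret linorder le lt by (fact assms(1))
  have "inj (inv \<pi>)"
    using assms(2) by (simp add: bij_imp_bij_inv bij_is_inj)
  then show ?thesis
    by unfold_locales (auto simp: pull_order_def inj_eq dest: order.antisym)
qed

lemma linorder_lex_le:
  assumes "class.linorder le lt"
  shows "class.linorder (lex_le lt) (\<lambda>u v. (u, v) \<in> lexord {(x, y). lt x y})"
proof -
  interpret linorder le lt by (fact assms)
  let ?r = "{(x, y). lt x y}"
  have tr: "trans ?r" and tot: "total ?r"
    by (auto simp: trans_def total_on_def)
  have irr: "(u, u) \<notin> lexord ?r" for u
    by (rule lexord_irreflexive) auto
  have trl: "(u, v) \<in> lexord ?r \<Longrightarrow> (v, w) \<in> lexord ?r \<Longrightarrow> (u, w) \<in> lexord ?r" for u v w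
    using tr lexord_trans by blast
  have totl: "u = v \<or> (u, v) \<in> lexord ?r \<or> (v, u) \<in> lexord ?r" for u v
    using total_lexord[OF tot] by (auto simp: total_on_def)
  show ?thesis
    by unfold_locales (use irr trl totl in \<open>unfold lex_le_def, blast+\<close>)
qed

lemma mset_concat_replicate_count:
  assumes "distinct xs" and "set w \<subseteq> set xs"
  shows "mset (concat (map (\<lambda>x. replicate (count_list w x) x) xs)) = mset w"
proof (rule multiset_eqI)
  fix z
  have "count (mset (concat (map (\<lambda>x. replicate (f x) x) xs))) z = (if z \<in> set xs then f z else 0)"
    for f :: "'a \<Rightarrow> nat"
    using assms(1) by (induction xs) auto
  moreover have "count_list w z = 0" if "z \<notin> set xs"
    using assms(2) that by (auto simp: count_list_0_iff)
  ultimately show "count (mset (concat (map (\<lambda>x. replicate (count_list w x) x) xs))) z = count (mset w) z"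
    by (simp add: count_mset)
qed

lemma sorted_wrt_concat_replicate:
  assumes "sorted_wrt R xs" and "\<And>x. R x x"
  shows "sorted_wrt R (concat (map (\<lambda>x. replicate (f x) x) xs))"
proof -
  have "sorted_wrt R (replicate n x)" for n x
    using assms(2) by (induction n) auto
  then show ?thesis
    using assms(1) by (induction xs) (auto simp: sorted_wrt_append)
qed

text \<open>
  The last letters of the successive rotations are the letters of the word in cyclic order, starting
  from its last letter.
\<close>

lemma mset_map_last_conjugates: "mset (map last (conjugates w)) = mset w"
proof (cases "w = []")
  case False
  have "map last (conjugates w) = rotate (length w - 1) w"
  proof (rule nth_equalityI)
    fix i assume "i < length (map last (conjugates w))"
    then have "i < length w"
      by (simp add: conjugates_def)
    then show "map last (conjugates w) ! i = rotate (length w - 1) w ! i"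
      using False by (auto simp: conjugates_def last_conv_nth nth_rotate add.commute)
  qed (simp add: conjugates_def)
  moreover have "mset (rotate n w) = mset w" for n
  proof (induction n)
    case (Suc n)
    then show ?case
      by (cases "rotate n w") auto
  qed simp
  ultimately show ?thesis
    by simp
qed (simp add: conjugates_def)

text \<open>
  Both the transform and the word required of it are rearrangements of \<open>w\<close>, and the latter is sorted
  for \<open>pull_order \<pi>\<close>. A multiset has only one sorted listing, so clustering says that the
  transform is sorted too. As the conjugates are listed in lexicographical order, this is a
  comparison of pairs of conjugates; equal conjugates are harmless, since they have equal last
  letters.
\<close>

theorem clusters_for_iff:
  assumes lin: "class.linorder le lt" and bij: "bij \<pi>"
  shows "clusters_for le lt \<pi> w \<longleftrightarrow> last_letters_monotone lt (pull_order \<pi> lt) w"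
proof -
  interpret linorder le lt by (fact lin)
  interpret P: linorder "pull_order \<pi> le" "pull_order \<pi> lt"
    using lin bij by (rule linorder_pull_order)
  interpret L: linorder "lex_le lt" "\<lambda>u v. (u, v) \<in> lexord {(x, y). lt x y}"
    using lin by (rule linorder_lex_le)
  define cs where "cs = L.sort_key (\<lambda>u. u) (conjugates w)"
  have set_cs: "set cs = set (conjugates w)"
    by (simp add: cs_def)
  have sorted_cs: "sorted_wrt (lex_le lt) cs"
    using L.sorted_sort_key[of "\<lambda>u. u" "conjugates w"] by (simp add: cs_def)
  have mset_cs: "mset (map last cs) = mset w"
    using mset_map_last_conjugates[of w] by (simp add: cs_def)
  define ls where "ls = map \<pi> (sorted_list_of_set UNIV)"
  have "sorted_wrt (\<lambda>x y. pull_order \<pi> le (\<pi> x) (\<pi> y)) (sorted_list_of_set UNIV)"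
    using bij by (simp add: pull_order_def bij_is_inj)
  then have ls: "sorted_wrt (pull_order \<pi> le) ls" "distinct ls" "set ls = UNIV"
    using bij by (auto simp: ls_def sorted_wrt_map distinct_map bij_is_inj bij_is_surj)
  define bs where "bs = concat (map (\<lambda>x. replicate (count_list w x) x) ls)"
  have mset_bs: "mset bs = mset w"
    unfolding bs_def using ls by (intro mset_concat_replicate_count) auto
  have sorted_bs: "sorted_wrt (pull_order \<pi> le) bs"
    unfolding bs_def using ls(1) by (intro sorted_wrt_concat_replicate) auto
  have "clusters_for le lt \<pi> w \<longleftrightarrow> map last cs = bs"
    by (simp add: clusters_for_def bwt_def cs_def bs_def ls_def comp_def)
  also have "\<dots> \<longleftrightarrow> sorted_wrt (pull_order \<pi> le) (map last cs)"
    using P.properties_for_sort[of bs w] P.properties_for_sort[of "map last cs" w]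
      mset_bs mset_cs sorted_bs by auto
  also have "\<dots> \<longleftrightarrow> sorted_wrt (\<lambda>u v. pull_order \<pi> le (last u) (last v)) cs"
    by (simp add: sorted_wrt_map)
  also have "\<dots> \<longleftrightarrow> last_letters_monotone lt (pull_order \<pi> lt) w"
  proof
    assume *: "sorted_wrt (\<lambda>u v. pull_order \<pi> le (last u) (last v)) cs"
    have "pull_order \<pi> le (last u) (last v)"
      if uv: "u \<in> set cs" "v \<in> set cs" "(u, v) \<in> lexord {(x, y). lt x y}" for u v
    proof -
      obtain i j where ij: "i < length cs" "cs ! i = u" "j < length cs" "cs ! j = v"
        using uv(1,2) by (auto simp: in_set_conv_nth)
      have "\<not> lex_le lt (cs ! j) (cs ! i)" "i \<noteq> j"
        using uv(3) ij L.not_le by auto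
      then have "\<not> j < i"
        using sorted_wrt_nth_less[OF sorted_cs, of j i] ij by auto
      then show ?thesis
        using sorted_wrt_nth_less[OF *, of i j] ij \<open>i \<noteq> j\<close> by auto
    qed
    then show "last_letters_monotone lt (pull_order \<pi> lt) w"
      by (auto simp: last_letters_monotone_def set_cs P.not_less)
  next
    assume "last_letters_monotone lt (pull_order \<pi> lt) w"
    then have "pull_order \<pi> le (last u) (last v)"
      if "u \<in> set cs" "v \<in> set cs" "lex_le lt u v" for u v
      using that unfolding last_letters_monotone_def set_cs lex_le_def P.not_less by auto
    then show "sorted_wrt (\<lambda>u v. pull_order \<pi> le (last u) (last v)) cs"
      using sorted_cs by (rule sorted_wrt_mono_rel)
  qed
  finally show ?thesis .
qed

section \<open>Conjugates\<close>

lemma set_conjugates: "w \<noteq> [] \<Longrightarrow> set (conjugates w) = range (\<lambda>i. rotate i w)"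
  by (auto simp: conjugates_def image_iff)
     (metis atLeastLessThan_iff length_greater_0_conv mod_less_divisor rotate_conv_mod zero_le)

lemma conjugates_trans:
  assumes "v \<in> set (conjugates u)" and "w \<in> set (conjugates v)"
  shows "w \<in> set (conjugates u)"
proof -
  have "u \<noteq> []" "v \<noteq> []"
    using assms by (auto simp: conjugates_def)
  then show ?thesis
    using assms by (auto simp: set_conjugates rotate_rotate)
qed

lemma mem_conjugates_iff:
  assumes "w \<noteq> []"
  shows "v \<in> set (conjugates w) \<longleftrightarrow> (\<exists>p q. w = p @ q \<and> v = q @ p)"
proof
  assume "v \<in> set (conjugates w)"
  then obtain i where "v = rotate i w"
    using assms by (auto simp: set_conjugates)
  then show "\<exists>p q. w = p @ q \<and> v = q @ p"
    by (metis append_take_drop_id rotate_drop_take)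
next
  assume "\<exists>p q. w = p @ q \<and> v = q @ p"
  then obtain p q where "w = p @ q" "v = q @ p"
    by blast
  then have "v = rotate (length p) w"
    by (simp only: rotate_append)
  then show "v \<in> set (conjugates w)"
    using assms by (simp add: set_conjugates)
qed

lemma append_swap_in_conjugates: "p @ q \<noteq> [] \<Longrightarrow> q @ p \<in> set (conjugates (p @ q))"
  by (subst mem_conjugates_iff, assumption) blast

lemma length_conjugates: "v \<in> set (conjugates w) \<Longrightarrow> length v = length w"
  by (auto simp: conjugates_def)

lemma set_conjugate: "v \<in> set (conjugates w) \<Longrightarrow> set v = set w"
  by (auto simp: conjugates_def)

section \<open>Conjugates of a substituted word\<close>

definition subst_after :: "'a \<Rightarrow> 'a list \<Rightarrow> 'a list" where
  "subst_after l u = concat (map (\<lambda>z. if z = l then [l] else [z, l]) u)"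

definition subst_before :: "'a \<Rightarrow> 'a list \<Rightarrow> 'a list" where
  "subst_before l u = concat (map (\<lambda>z. if z = l then [l] else [l, z]) u)"

lemma subst_after_simps [simp]:
  "subst_after l [] = []"
  "subst_after l (z # u) = (if z = l then [l] else [z, l]) @ subst_after l u"
  "subst_after l (u @ v) = subst_after l u @ subst_after l v"
  by (simp_all add: subst_after_def)

lemma subst_after_eq_Nil_iff [simp]: "subst_after l u = [] \<longleftrightarrow> u = []"
  by (cases u) auto

lemma subst_before_simps [simp]:
  "subst_before l [] = []"
  "subst_before l (z # u) = (if z = l then [l] else [l, z]) @ subst_before l u"
  "subst_before l (u @ v) = subst_before l u @ subst_before l v"
  by (simp_all add: subst_before_def)

lemma subst_before_eq_Nil_iff [simp]: "subst_before l u = [] \<longleftrightarrow> u = []"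
  by (cases u) auto

text \<open>
  The two substitutions are conjugate to each other by the letter \<open>l\<close>. Through this identity
  comparisons move from one to the other: \<open>subst_after\<close> keeps the first letter of every block,
  hence the place where two words first differ, and \<open>subst_before\<close> keeps the last.
\<close>

lemma Cons_subst_after: "l # subst_after l u = subst_before l u @ [l]"
  by (induction u) auto

lemma subst_before_eq_Cons: "u \<noteq> [] \<Longrightarrow> \<exists>u'. subst_before l u = l # u'"
  by (cases u) auto

lemma subst_before_in_conjugates:
  assumes "u \<noteq> []"
  shows "subst_before l u \<in> set (conjugates (subst_after l u))"
proof -
  obtain u' where "subst_before l u = l # u'"
    using subst_before_eq_Cons[OF assms] by blast
  then have "subst_after l u = u' @ [l]" "subst_before l u = [l] @ u'"
    using Cons_subst_after[of l u] by auto
  then show ?thesis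
    using append_swap_in_conjugates[of u' "[l]"] by simp
qed

lemma last_subst_before: "u \<noteq> [] \<Longrightarrow> last (subst_before l u) = last u"
  by (cases u rule: rev_cases) auto

lemma last_subst_after: "u \<noteq> [] \<Longrightarrow> last (subst_after l u) = l"
  by (cases u rule: rev_cases) auto

lemma subst_after_split:
  assumes "subst_after l u = p @ q"
  obtains (clean) u1 u2 where "u = u1 @ u2" "p = subst_after l u1" "q = subst_after l u2"
  | (cut) u1 x u2 where "u = u1 @ x # u2" "x \<noteq> l" "p = subst_after l u1 @ [x]" "q = l # subst_after l u2"
  using assms
proof (induction u arbitrary: p thesis)
  case Nil
  then show ?case by (metis append_Nil append_is_Nil_conv subst_after_simps(1))
next
  case (Cons z u)
  show ?case
  proof (cases "p = []")
    case True
    then show ?thesis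
      using Cons.prems(1)[of "[]" "z # u"] Cons.prems(3) by simp
  next
    case p: False
    show ?thesis
    proof (cases "z \<noteq> l \<and> p = [z]")
      case True
      then show ?thesis
        using Cons.prems(2)[of "[]" z u] Cons.prems(3) by simp
    next
      case False
      then obtain p' where p': "p = subst_after l [z] @ p'" "subst_after l u = p' @ q"
        using p Cons.prems(3) by (auto simp: append_eq_append_conv2 Cons_eq_append_conv split: if_splits)
      show ?thesis
      proof (rule Cons.IH[OF _ _ p'(2)])
        fix u1 u2 assume "u = u1 @ u2" "p' = subst_after l u1" "q = subst_after l u2"
        then show ?thesis
          using Cons.prems(1)[of "z # u1" u2] p'(1) by simp
      next
        fix u1 x u2 assume "u = u1 @ x # u2" "x \<noteq> l" "p' = subst_after l u1 @ [x]" "q = l # subst_after l u2"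
        then show ?thesis
          using Cons.prems(2)[of "z # u1" x u2] p'(1) by simp
      qed
    qed
  qed
qed

text \<open>
  A rotation that starts inside a block \<open>[x, l]\<close> starts with its \<open>l\<close> and ends with \<open>x\<close>, so the \<open>l\<close> of
  each block can be read as the start of the next one: the rotation is an image under
  \<open>subst_before\<close>. So is a rotation that starts with a one-letter block \<open>[l]\<close>. What is left are
  the rotations that start with a full block \<open>[x, l]\<close>.
\<close>

lemma conjugate_subst_after_cases:
  assumes "v \<in> set (conjugates (subst_after l u))"
  obtains (image) s where "s \<in> set (conjugates u)" "v = subst_before l s"
  | (inside) x v' where "x \<in> set u" "x \<noteq> l" "v = x # v'" "last v = l"
proof -
  have u: "u \<noteq> []"
    using assms by (auto simp: conjugates_def)
  then obtain p q where pq: "subst_after l u = p @ q" "v = q @ p"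
    using assms by (auto simp: mem_conjugates_iff)
  from pq(1) show thesis
  proof (cases rule: subst_after_split)
    case (clean u1 u2)
    define s where "s = u2 @ u1"
    have s: "s \<in> set (conjugates u)" "v = subst_after l s"
      using u clean pq(2) append_swap_in_conjugates[of u1 u2] by (simp_all add: s_def)
    have "s \<noteq> []"
      using clean(1) u by (auto simp: s_def)
    then obtain x s' where xs: "s = x # s'"
      by (auto simp: neq_Nil_conv)
    show thesis
    proof (cases "x = l")
      case True
      have "s' @ [l] \<in> set (conjugates s)"
        using xs True append_swap_in_conjugates[of "[l]" s'] by simp
      then have "s' @ [l] \<in> set (conjugates u)"
        using s(1) conjugates_trans by blast
      moreover have "v = subst_before l (s' @ [l])"
        using s(2) xs True by (simp add: Cons_subst_after)
      ultimately show thesis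
        by (rule image)
    next
      case False
      have "x \<in> set u"
        using set_conjugate[OF s(1)] xs by auto
      moreover have "v = x # l # subst_after l s'" "last v = l"
        using s(2) xs False last_subst_after[of s l] by auto
      ultimately show thesis
        using False inside by blast
    qed
  next
    case (cut u1 x u2)
    have "u2 @ u1 @ [x] \<in> set (conjugates u)"
      using cut(1) append_swap_in_conjugates[of "u1 @ [x]" u2] by simp
    moreover have "v = subst_before l (u2 @ u1 @ [x])"
    proof -
      have "v = (l # subst_after l (u2 @ u1)) @ [x]"
        using pq(2) cut by simp
      then show ?thesis
        using cut(2) by (simp only: Cons_subst_after) simp
    qed
    ultimately show thesis
      by (rule image)
  qed
qed

lemma subst_after_conjugate:
  assumes "s \<in> set (conjugates u)"
  shows "subst_after l s \<in> set (conjugates (subst_after l u))"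
proof -
  have u: "u \<noteq> []"
    using assms by (auto simp: conjugates_def)
  then obtain p q where "u = p @ q" "s = q @ p"
    using assms by (auto simp: mem_conjugates_iff)
  then show ?thesis
    using u append_swap_in_conjugates[of "subst_after l p" "subst_after l q"] by simp
qed

lemma subst_before_conjugate:
  assumes "s \<in> set (conjugates u)"
  shows "subst_before l s \<in> set (conjugates (subst_after l u))"
proof -
  have "s \<noteq> []"
    using assms by (auto simp: conjugates_def)
  then show ?thesis
    using assms subst_after_conjugate subst_before_in_conjugates conjugates_trans by metis
qed

lemma conjugate_starting_with:
  assumes "x \<in> set u"
  obtains s where "x # s \<in> set (conjugates u)"
proof -
  obtain p q where "u = p @ x # q"
    using assms split_list by fast
  then show thesis
    using that[of "q @ p"] append_swap_in_conjugates[of p "x # q"] by simp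
qed

lemma conjugate_ending_with:
  assumes "x \<in> set u"
  obtains s where "s @ [x] \<in> set (conjugates u)"
proof -
  obtain p q where "u = p @ x # q"
    using assms split_list by fast
  then show thesis
    using that[of "q @ p"] append_swap_in_conjugates[of "p @ [x]" q] by simp
qed

text \<open>
  The monotonicity is evident for \<open>subst_after\<close>, as blocks of different letters have different
  first letters. It is passed on to \<open>subst_before\<close> by \<open>Cons_subst_after\<close>: prefixing both words with
  \<open>l\<close> changes nothing, and removing the common last letter \<open>l\<close> is harmless for distinct words of
  equal length.
\<close>

lemma lexord_subst_before_mono:
  assumes st: "(s, t) \<in> lexord r" and len: "length (subst_before l s) = length (subst_before l t)"
    and len': "length s = length t" and irr: "\<And>x. (x, x) \<notin> r"
  shows "(subst_before l s, subst_before l t) \<in> lexord r"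
proof -
  have "(subst_after l s, subst_after l t) \<in> lexord r"
    using st len'
  proof (induction s arbitrary: t)
    case (Cons x s)
    then obtain y t' where t: "t = y # t'"
      by (cases t) auto
    show ?case
    proof (cases "x = y")
      case True
      then show ?thesis
        using Cons t irr by (auto intro!: lexord_append_leftI)
    next
      case False
      then show ?thesis
        using Cons.prems t by auto
    qed
  qed auto
  then have "(subst_before l s @ [l], subst_before l t @ [l]) \<in> lexord r"
    by (simp flip: Cons_subst_after)
  moreover have "(w, w) \<notin> lexord r" for w
    using irr by (intro lexord_irreflexive) auto
  ultimately show ?thesis
    using len by (metis lexord_sufE)
qed

section \<open>Effect of one rule on clustering\<close>

text \<open>
  The parameters \<open>s\<close> and \<open>t\<close> range independently: unless \<open>S\<close> has no letter but \<open>l\<close>, the condition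
  puts \<open>l\<close> below all other letters of \<open>S\<close> in one order and above all of them in the other.
\<close>

definition compatible_at :: "('a \<Rightarrow> 'a \<Rightarrow> bool) \<Rightarrow> ('a \<Rightarrow> 'a \<Rightarrow> bool) \<Rightarrow> 'a \<Rightarrow> 'a set \<Rightarrow> bool" where
  "compatible_at lt lt' l S \<longleftrightarrow> (\<forall>s \<in> S - {l}. \<forall>t \<in> S - {l}. lt l t \<longleftrightarrow> lt' s l)"

text \<open>
  Among conjugates that begin with \<open>l\<close> the condition is the one for \<open>u\<close>, and two conjugates
  that begin with other letters both end with \<open>l\<close>. The mixed comparisons give \<open>compatible_at\<close>: a
  conjugate that begins with \<open>l\<close> can end with any letter \<open>s\<close> of \<open>u\<close>, the other one begins with any
  letter \<open>t \<noteq> l\<close> of \<open>u\<close> and ends with \<open>l\<close>, and their order is that of \<open>l\<close> and \<open>t\<close>.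
\<close>

theorem last_letters_monotone_subst_after:
  assumes lin: "class.linorder le lt" and lin': "class.linorder le' lt'"
  shows "last_letters_monotone lt lt' (subst_after l u) \<longleftrightarrow>
    last_letters_monotone lt lt' u \<and> compatible_at lt lt' l (set u)"
proof -
  interpret linorder le lt by (fact lin)
  interpret O': linorder le' lt' by (fact lin')
  interpret L: linorder "lex_le lt" "\<lambda>u v. (u, v) \<in> lexord {(x, y). lt x y}"
    using lin by (rule linorder_lex_le)
  let ?r = "{(x, y). lt x y}"
  have ne: "s \<noteq> []" if "s \<in> set (conjugates u)" for s
    using that by (auto simp: conjugates_def)
  have mono: "(subst_before l s, subst_before l t) \<in> lexord ?r"
    if "s \<in> set (conjugates u)" "t \<in> set (conjugates u)" "(s, t) \<in> lexord ?r" for s t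
  proof (rule lexord_subst_before_mono[OF that(3)])
    show "length (subst_before l s) = length (subst_before l t)"
      using that(1,2)[THEN subst_before_conjugate[of _ _ l], THEN length_conjugates] by simp
    show "length s = length t"
      using that(1,2)[THEN length_conjugates] by simp
  qed auto
  have reflect: "(s, t) \<in> lexord ?r"
    if "s \<in> set (conjugates u)" "t \<in> set (conjugates u)"
      "(subst_before l s, subst_before l t) \<in> lexord ?r" for s t
  proof (rule ccontr)
    assume "(s, t) \<notin> lexord ?r"
    then consider "s = t" | "(t, s) \<in> lexord ?r"
      using L.less_linear[of s t] by blast
    then show False
    proof cases
      case 2
      then show False
        using mono[OF that(2,1)] that(3) L.less_asym by blast
    qed (use that(3) L.less_irrefl in blast)
  qed
  show ?thesis
  proof (intro iffI conjI)
    assume *: "last_letters_monotone lt lt' (subst_after l u)"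
    show "last_letters_monotone lt lt' u"
      unfolding last_letters_monotone_def
    proof (intro ballI impI)
      fix s t assume "s \<in> set (conjugates u)" "t \<in> set (conjugates u)" "(s, t) \<in> lexord ?r"
      then show "\<not> lt' (last t) (last s)"
        using * mono[of s t] subst_before_conjugate[of _ u l] last_subst_before[of _ l] ne
        unfolding last_letters_monotone_def by metis
    qed
    show "compatible_at lt lt' l (set u)"
      unfolding compatible_at_def
    proof (intro ballI)
      fix x y assume xy: "x \<in> set u - {l}" "y \<in> set u - {l}"
      obtain s where s: "s @ [x] \<in> set (conjugates u)"
        using xy(1) conjugate_ending_with[of x u] by blast
      obtain t where t: "y # t \<in> set (conjugates u)"
        using xy(2) conjugate_starting_with[of y u] by blast
      \<comment> \<open>Comparing a conjugate that runs from \<open>l\<close> to \<open>x\<close> with one that runs from \<open>y\<close> to \<open>l\<close>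
        gives the condition on \<open>x\<close> and \<open>y\<close>.\<close>
      define P where "P = subst_before l (s @ [x])"
      define Q where "Q = subst_after l (y # t)"
      have P: "P \<in> set (conjugates (subst_after l u))" "last P = x"
        using subst_before_conjugate[OF s, of l] xy(1) by (auto simp: P_def)
      have Q: "Q \<in> set (conjugates (subst_after l u))" "last Q = l"
      proof -
        show "Q \<in> set (conjugates (subst_after l u))"
          using subst_after_conjugate[OF t] by (simp only: Q_def)
        show "last Q = l"
          unfolding Q_def by (rule last_subst_after) simp
      qed
      obtain P' where P': "P = l # P'"
        using subst_before_eq_Cons[of "s @ [x]" l] by (auto simp: P_def)
      obtain Q' where Q': "Q = y # Q'"
        using xy(2) unfolding Q_def by auto
      have PQ: "lt l y \<Longrightarrow> (P, Q) \<in> lexord ?r" "lt y l \<Longrightarrow> (Q, P) \<in> lexord ?r"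
        by (simp_all add: P' Q')
      have agree: "(v, w) \<in> lexord ?r \<longrightarrow> \<not> lt' (last w) (last v)"
        if "v \<in> {P, Q}" "w \<in> {P, Q}" for v w
        using * P(1) Q(1) that unfolding last_letters_monotone_def by auto
      have "lt l y \<longrightarrow> \<not> lt' l x" "lt y l \<longrightarrow> \<not> lt' x l"
        using agree[of P Q] agree[of Q P] PQ unfolding P(2) Q(2) by simp_all
      moreover have "lt l y \<or> lt y l" "lt' l x \<or> lt' x l"
        using xy less_linear[of l y] O'.less_linear[of l x] by auto
      moreover have "\<not> (lt l y \<and> lt y l)"
        using less_asym by blast
      ultimately show "lt l y \<longleftrightarrow> lt' x l"
        by argo
    qed
  next
    assume "last_letters_monotone lt lt' u \<and> compatible_at lt lt' l (set u)"
    then have agree: "last_letters_monotone lt lt' u" and comp: "compatible_at lt lt' l (set u)"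
      by auto
    have key: "lt l x \<Longrightarrow> \<not> lt' l (last s)" "lt x l \<Longrightarrow> \<not> lt' (last s) l"
      if "s \<in> set (conjugates u)" "x \<in> set u" "x \<noteq> l" for s x
    proof -
      have "last s \<in> set u"
        using ne[OF that(1)] set_conjugate[OF that(1)] last_in_set by metis
      then have "lt l x \<longleftrightarrow> lt' (last s) l" if "last s \<noteq> l"
        using comp that \<open>x \<in> set u\<close> \<open>x \<noteq> l\<close> unfolding compatible_at_def by simp
      moreover have "\<not> (lt l x \<and> lt x l)" "\<not> (lt' l (last s) \<and> lt' (last s) l)"
        using less_asym O'.less_asym by blast+
      moreover have "\<not> lt' l (last s)" "\<not> lt' (last s) l" if "last s = l"
        using that by simp_all
      ultimately show "lt l x \<Longrightarrow> \<not> lt' l (last s)" "lt x l \<Longrightarrow> \<not> lt' (last s) l"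
        by argo+
    qed
    show "last_letters_monotone lt lt' (subst_after l u)"
      unfolding last_letters_monotone_def
    proof (intro ballI impI)
      fix P Q
      assume P: "P \<in> set (conjugates (subst_after l u))" and Q: "Q \<in> set (conjugates (subst_after l u))"
        and less: "(P, Q) \<in> lexord ?r"
      from P show "\<not> lt' (last Q) (last P)"
      proof (cases rule: conjugate_subst_after_cases)
        case s: (image s)
        from Q show ?thesis
        proof (cases rule: conjugate_subst_after_cases)
          case t: (image t)
          have "(s, t) \<in> lexord ?r"
            using reflect s t less by simp
          then have "\<not> lt' (last t) (last s)"
            using agree s(1) t(1) unfolding last_letters_monotone_def by simp
          then show ?thesis
            using s t ne by (simp add: last_subst_before)
        next
          case x: (inside x Q')
          obtain P' where "P = l # P'"
            using s(2) subst_before_eq_Cons[OF ne[OF s(1)], of l] by auto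
          then have "lt l x"
            using less x by auto
          then show ?thesis
            using key(1)[OF s(1) x(1,2)] x(4) s(2) ne[OF s(1)] by (simp add: last_subst_before)
        qed
      next
        case x: (inside x P')
        from Q show ?thesis
        proof (cases rule: conjugate_subst_after_cases)
          case t: (image t)
          obtain Q' where "Q = l # Q'"
            using t(2) subst_before_eq_Cons[OF ne[OF t(1)], of l] by auto
          then have "lt x l"
            using less x by auto
          then show ?thesis
            using key(2)[OF t(1) x(1,2)] x(4) t(2) ne[OF t(1)] by (simp add: last_subst_before)
        next
          case y: (inside y Q')
          then show ?thesis
            using x by simp
        qed
      qed
    qed
  qed
qed

section \<open>Clustering of Arnoux-Rauzy words\<close>

text \<open>
  The recursion defining \<open>ar_word\<close> substitutes with the latest rule innermost. Read from the
  outside, the word is an image under the substitution of the rule at stage \<open>0\<close>, which is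
  what lets one rule be removed while the remaining word keeps its form.
\<close>

lemma ar_word_Suc_left:
  "ar_word r (Suc p) z = subst_after (r 0) (ar_word (\<lambda>k. r (Suc k)) p z)"
proof (induction p arbitrary: z)
  case (Suc p)
  then show ?case
    by (subst ar_word.simps(2)) (simp del: ar_word.simps(2) add: ar_word.simps(2)[of _ p])
qed simp

lemma set_ar_word: "set (ar_word r p z) = insert z (r ` {..<p})"
  by (induction p arbitrary: z) (auto simp: lessThan_Suc)

theorem last_letters_monotone_ar_word:
  assumes lin: "class.linorder le lt" and lin': "class.linorder le' lt'"
  shows "last_letters_monotone lt lt' (ar_word r p z) \<longleftrightarrow>
    (\<forall>k<p. compatible_at lt lt' (r k) (insert z (r ` {k<..<p})))"
proof (induction p arbitrary: r)
  case 0
  interpret O': linorder le' lt' by (fact lin')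
  show ?case
    by (auto simp: last_letters_monotone_def conjugates_def)
next
  case (Suc p)
  have shift: "(\<lambda>k. r (Suc k)) ` {k<..<p} = r ` {Suc k<..<Suc p}" for k
  proof -
    have "Suc ` {k<..<p} = {Suc k<..<Suc p}"
      by (metis atLeastSucLessThan_greaterThanLessThan image_Suc_atLeastLessThan)
    then show ?thesis
      using image_image[of r Suc "{k<..<p}"] by simp
  qed
  have first: "(\<lambda>k. r (Suc k)) ` {..<p} = r ` {0<..<Suc p}"
  proof -
    have "Suc ` {..<p} = {0<..<Suc p}"
      by (simp add: lessThan_atLeast0 atLeastSucLessThan_greaterThanLessThan)
    then show ?thesis
      using image_image[of r Suc "{..<p}"] by simp
  qed
  show ?case
    unfolding ar_word_Suc_left last_letters_monotone_subst_after[OF lin lin'] Suc.IH set_ar_word first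
      shift All_less_Suc2 by blast
qed

corollary clusters_ar_word_iff_compatible:
  "clusters (ar_word r p z) \<longleftrightarrow>
    (\<exists>le lt \<pi>. class.linorder le lt \<and> bij \<pi> \<and> \<pi> \<noteq> id \<and>
      (\<forall>k<p. compatible_at lt (pull_order \<pi> lt) (r k) (insert z (r ` {k<..<p}))))"
proof -
  have "clusters_for le lt \<pi> (ar_word r p z) \<longleftrightarrow>
      (\<forall>k<p. compatible_at lt (pull_order \<pi> lt) (r k) (insert z (r ` {k<..<p})))"
    if "class.linorder le lt" "bij \<pi>" for le lt \<pi>
    using that by (simp add: clusters_for_iff last_letters_monotone_ar_word[OF _ linorder_pull_order])
  then show ?thesis
    unfolding clusters_def by blast
qed

section \<open>Three letters\<close>

text \<open>
  The order \<open>a < c < b\<close>, with \<open>c\<close> in the middle because rules \<open>(a)\<close> and \<open>(b)\<close> come first and ask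
  for extremal letters. Exchanging \<open>a\<close> and \<open>b\<close> reverses it.
\<close>

definition acb_rank :: "letter \<Rightarrow> nat" where
  "acb_rank z = (case z of La \<Rightarrow> 0 | Lc \<Rightarrow> 1 | Lb \<Rightarrow> 2)"

definition swap_ab :: "letter \<Rightarrow> letter" where
  "swap_ab z = (case z of La \<Rightarrow> Lb | Lb \<Rightarrow> La | Lc \<Rightarrow> Lc)"

lemma inj_acb_rank: "acb_rank y = acb_rank z \<longleftrightarrow> y = z"
  by (simp add: acb_rank_def split: letter.splits)

lemma swap_ab_swap_ab [simp]: "swap_ab (swap_ab z) = z"
  by (simp add: swap_ab_def split: letter.splits)

lemma bij_swap_ab: "bij swap_ab"
  by (rule involuntory_imp_bij) simp

lemma inv_swap_ab: "inv swap_ab = swap_ab"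
  by (rule inv_equality) simp_all

lemma linorder_acb:
  "class.linorder (\<lambda>y z. acb_rank y \<le> acb_rank z) (\<lambda>y z. acb_rank y < acb_rank z)"
  by unfold_locales (auto simp flip: inj_acb_rank)

lemma compatible_at_acb:
  "compatible_at (\<lambda>y z. acb_rank y < acb_rank z)
     (pull_order swap_ab (\<lambda>y z. acb_rank y < acb_rank z)) l S \<longleftrightarrow>
   l \<noteq> Lc \<or> \<not> {La, Lb} \<subseteq> S"
  unfolding compatible_at_def pull_order_def inv_swap_ab
  by (cases l) (auto simp: acb_rank_def swap_ab_def split: letter.splits)

text \<open>
  If \<open>a\<close> and \<open>b\<close> both remain after stage \<open>n\<close>, then stages \<open>0\<close>, \<open>m\<close> and \<open>n\<close> ask \<open>a\<close>, \<open>b\<close> and \<open>c\<close> in turn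
  to be extremal among all three letters, and no linear order allows that. Otherwise the order
  \<open>a < c < b\<close> works: no rule \<open>(c)\<close> occurs before stage \<open>n\<close>, and the set of letters that remain after
  a stage only shrinks as the stage grows.
\<close>

lemma clusters_ar_word_iff:
  assumes r0: "r 0 = La" and m: "m < n" "r m = Lb"
    and n: "r n = Lc" "\<And>k. k < n \<Longrightarrow> r k \<noteq> Lc"
  shows "clusters (ar_word r p z) \<longleftrightarrow> p \<le> n \<or> \<not> {La, Lb} \<subseteq> insert z (r ` {n<..<p})"
proof
  assume "clusters (ar_word r p z)"
  then obtain le lt \<pi> where lin: "class.linorder le lt" and bij: "bij \<pi>"
    and comp: "\<And>k. k < p \<Longrightarrow> compatible_at lt (pull_order \<pi> lt) (r k) (insert z (r ` {k<..<p}))"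
    unfolding clusters_ar_word_iff_compatible by blast
  interpret linorder le lt by (fact lin)
  have extremal: "lt l s \<longleftrightarrow> lt l t"
    if "compatible_at lt (pull_order \<pi> lt) l S" "s \<in> S" "t \<in> S" "s \<noteq> l" "t \<noteq> l" for l S s t
    using that unfolding compatible_at_def by blast
  show "p \<le> n \<or> \<not> {La, Lb} \<subseteq> insert z (r ` {n<..<p})"
  proof (rule ccontr)
    assume "\<not> ?thesis"
    then have p: "n < p" and ab: "{La, Lb} \<subseteq> insert z (r ` {n<..<p})"
      by auto
    have later: "insert z (r ` {n<..<p}) \<subseteq> insert z (r ` {k<..<p})" if "k < n" for k
      using that by auto
    have c: "Lc \<in> insert z (r ` {k<..<p})" if "k < n" for k
      using that p imageI[of n "{k<..<p}" r] n(1) by simp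
    have "lt Lc La \<longleftrightarrow> lt Lc Lb"
      using extremal[OF comp[of n]] p ab n(1) by auto
    moreover have "lt La Lb \<longleftrightarrow> lt La Lc"
      using extremal[OF comp[of 0], of Lb Lc] p ab later[of 0] c[of 0] r0 m by auto
    moreover have "lt Lb La \<longleftrightarrow> lt Lb Lc"
      using extremal[OF comp[of m], of La Lc] p ab later[of m] c[of m] m by auto
    moreover have "lt La Lb \<or> lt Lb La" "lt La Lc \<or> lt Lc La" "lt Lb Lc \<or> lt Lc Lb"
      using less_linear[of La Lb] less_linear[of La Lc] less_linear[of Lb Lc] by simp_all
    moreover have "\<not> (lt La Lb \<and> lt Lb La)" "\<not> (lt La Lc \<and> lt Lc La)" "\<not> (lt Lb Lc \<and> lt Lc Lb)"
      using less_asym by blast+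
    ultimately show False
      by argo
  qed
next
  assume *: "p \<le> n \<or> \<not> {La, Lb} \<subseteq> insert z (r ` {n<..<p})"
  have "r k \<noteq> Lc \<or> \<not> {La, Lb} \<subseteq> insert z (r ` {k<..<p})" if "k < p" for k
  proof (cases "k < n")
    case False
    then have "insert z (r ` {k<..<p}) \<subseteq> insert z (r ` {n<..<p})"
      by auto
    then show ?thesis
      using * that False by auto
  qed (use n(2) in simp)
  moreover have "swap_ab \<noteq> id"
  proof
    assume "swap_ab = id"
    then have "swap_ab La = La"
      by simp
    then show False
      by (simp add: swap_ab_def)
  qed
  ultimately show "clusters (ar_word r p z)"
    unfolding clusters_ar_word_iff_compatible
    by (intro exI[of _ "\<lambda>y z. acb_rank y \<le> acb_rank z"] exI[of _ "\<lambda>y z. acb_rank y < acb_rank z"]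
        exI[of _ swap_ab] conjI linorder_acb bij_swap_ab) (simp_all add: compatible_at_acb)
qed

theorem proposition12:
  fixes r :: "nat \<Rightarrow> letter" and \<Lambda> :: "letter list set"
    and x y :: letter and \<mu> :: "letter \<Rightarrow> nat" and p :: nat
  assumes "ar_language r \<Lambda>"
    and "Rabc r"
    and "\<mu> = first_after_c r"
    and "{x, y} = {La, Lb}"
    and "\<mu> x < \<mu> y"
  shows "(clusters (ar_word r p y) \<longleftrightarrow> p \<le> \<mu> x)
    \<and> (clusters (ar_word r p Lc) \<longleftrightarrow> p \<le> \<mu> y)
    \<and> (clusters (ar_word r p x) \<longleftrightarrow> p \<le> \<mu> y)"
proof -
  have inf: "infinite {k. r k = z}" for z
    using assms(1) by (simp add: ar_language_def)
  have later: "\<exists>k>j. r k = z" for j z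
    using inf[of z] by (auto simp: finite_nat_set_iff_bounded_le not_le)
  define m where "m = (LEAST k. r k \<noteq> La)"
  define n where "n = first_c r"
  have r0: "r 0 = La" and m: "r m = Lb"
    using assms(2) by (simp_all add: Rabc_def m_def)
  have n: "r n = Lc"
    unfolding n_def first_c_def by (rule LeastI_ex) (use later[of 0 Lc] in blast)
  have before_n: "r k \<noteq> Lc" if "k < n" for k
    using that unfolding n_def first_c_def by (rule not_less_Least)
  have "m \<le> n"
    unfolding m_def using n by (intro Least_le) simp
  then have "m < n"
    using m n by (cases "m = n") auto
  note clusters = clusters_ar_word_iff[OF r0 \<open>m < n\<close> m n before_n]
  have \<mu>: "n < \<mu> z \<and> r (\<mu> z) = z" for z
    unfolding assms(3) first_after_c_def n_def by (rule LeastI_ex[OF later])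
  have \<mu>_le: "\<mu> z \<le> k" if "n < k" "r k = z" for z k
    using that unfolding assms(3) first_after_c_def n_def by (auto intro: Least_le)
  have occurs: "z \<in> r ` {n<..<p} \<longleftrightarrow> \<mu> z < p" for z
  proof
    assume "z \<in> r ` {n<..<p}"
    then obtain k where "n < k" "k < p" "r k = z"
      by auto
    then show "\<mu> z < p"
      using \<mu>_le[of k z] by simp
  next
    assume "\<mu> z < p"
    then show "z \<in> r ` {n<..<p}"
      using \<mu>[of z] by (intro image_eqI[of _ _ "\<mu> z"]) simp_all
  qed
  have "x \<noteq> y" "x \<noteq> Lc" "y \<noteq> Lc"
    using assms(4,5) by auto
  then have "{La, Lb} \<subseteq> insert y (r ` {n<..<p}) \<longleftrightarrow> \<mu> x < p"
    "{La, Lb} \<subseteq> insert Lc (r ` {n<..<p}) \<longleftrightarrow> \<mu> x < p \<and> \<mu> y < p"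
    "{La, Lb} \<subseteq> insert x (r ` {n<..<p}) \<longleftrightarrow> \<mu> y < p"
    unfolding assms(4)[symmetric] by (simp_all add: occurs)
  then show ?thesis
    using \<mu>[of x] \<mu>[of y] assms(5) by (simp only: clusters) linarith
qed

end
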